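(* Let $A$ be a vector space with bilinear multiplications $\succ_A,\prec_A:A\otimes A\to A$, and define $$x\circ_A y:=x\succ_A y+x\prec_A y,\qquad x\bullet_A y:=x\succ_A y-y\prec_A x,\qquad\forall x,y\in A.$$ Then the following statements are equivalent. (a) $(A,\succ_A,\prec_A)$ is a type-$a$ pre-Leibniz algebra, where $a=\begin{pmatrix} 1 & -1 \\ -1 & 0 \end{pmatrix}$. (b) $(A,\succ_A,\prec_A)$ is a dual type-$b$ pre-Leibniz algebra, where $b=\begin{pmatrix} 1 & 0 \\ -1 & 1 \end{pmatrix}$. (c) $(A,\circ_A)$ is a Leibniz algebra and the following equations hold for all $x,y,z\in A$: $$(x\circ_A y)\bullet_A z=x\bullet_A(y\bullet_A z)-y\bullet_A(x\bullet_A z),$$ $$z\prec_A(x\circ_A y)=x\bullet_A(z\prec_A y)-(x\bullet_A z)\prec_A y,$$ $$x\bullet_A(z\prec_A y)=-(z\prec_A y)\prec_A x.$$ Moreover, in this case both $(L^*_{\bullet_A},R^*_{\prec_A},A^* )$ and $(L_{\bullet_A},-L_{\succ_A},A)$ are representations of the Leibniz algebra $(A,\circ_A)$.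
   Context: All vector spaces are finite-dimensional over an algebraically closed field $\mathbb{K}$ of characteristic zero. A Leibniz algebra is a vector space $A$ with a bilinear multiplication $\circ_A$ such that $x\circ_A(y\circ_A z)=(x\circ_A y)\circ_A z+y\circ_A(x\circ_A z)$ for all $x,y,z\in A$. A representation of a Leibniz algebra $(A,\circ_A)$ is a triple $(l,r,V)$ with $V$ a vector space and $l,r:A\to\mathrm{End}_{\mathbb{K}}(V)$ linear maps such that for all $x,y\in A$: $l(x\circ_A y)=l(x)l(y)-l(y)l(x)$, $r(x\circ_A y)=l(x)r(y)-r(y)l(x)$, $r(y)l(x)=-r(y)r(x)$. For a multiplication $\ast$ on $A$, set $L_\ast(x)y=x\ast y$ and $R_\ast(x)y=y\ast x$. For a linear map $\rho:A\to\mathrm{End}_{\mathbb{K}}(V)$, $\rho^*:A\to\mathrm{End}_{\mathbb{K}}(V^* )$ is defined by $\langle\rho^*(x)u^*,v\rangle=-\langle u^*,\rho(x)v\rangle$. For a matrix $M=\begin{pmatrix} a_1 & b_1 \\ a_2 & b_2 \end{pmatrix}\in M_2(\mathbb{K})$, a triple $(A,\succ_A,\prec_A)$ is a type-$M$ pre-Leibniz algebra (resp. a dual type-$M$ pre-Leibniz algebra) if $(A,\circ_A=\succ_A+\prec_A)$ is a Leibniz algebra and $(a_1L_{\succ_A}+a_2R_{\prec_A},\,b_1L_{\succ_A}+b_2R_{\prec_A},\,A)$ (resp. $(a_1L^*_{\succ_A}+a_2R^*_{\prec_A},\,b_1L^*_{\succ_A}+b_2R^*_{\prec_A},\,A^*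 )$) is a representation of $(A,\circ_A)$. *)

theory Defs
  imports
    "HOL-Analysis.Analysis"
    "HOL-Library.Function_Algebras"
    "HOL-Computational_Algebra.Computational_Algebra"
begin

text \<open>
  A Leibniz algebra lives on a whole type \<open>'a\<close>, with scalar multiplication \<open>s\<close>. A representation
  space is a subspace \<open>V\<close> of an ambient type, so that the dual space (the set of linear functionals
  inside the function type \<open>'a \<Rightarrow> 'k\<close>, which is an abelian group pointwise) is allowed;
  everything about operators on \<open>V\<close> is relativised to \<open>V\<close>.
\<close>

definition findim_space_on :: "('k::field \<Rightarrow> 'v::ab_group_add \<Rightarrow> 'v) \<Rightarrow> 'v set \<Rightarrow> bool" where
  "findim_space_on s V \<longleftrightarrow> vector_space s \<and> (\<exists>B. finite B \<and> module.span s B = V)"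

definition bilinear_mult :: "('k::field \<Rightarrow> 'a::ab_group_add \<Rightarrow> 'a) \<Rightarrow> ('a \<Rightarrow> 'a \<Rightarrow> 'a) \<Rightarrow> bool" where
  "bilinear_mult s m \<longleftrightarrow>
     (\<forall>x. Vector_Spaces.linear s s (\<lambda>y. m x y)) \<and> (\<forall>y. Vector_Spaces.linear s s (\<lambda>x. m x y))"

definition leibniz_algebra :: "('k::field \<Rightarrow> 'a::ab_group_add \<Rightarrow> 'a) \<Rightarrow> ('a \<Rightarrow> 'a \<Rightarrow> 'a) \<Rightarrow> bool" where
  "leibniz_algebra s m \<longleftrightarrow>
     findim_space_on s UNIV \<and> bilinear_mult s m \<and>
     (\<forall>x y z. m x (m y z) = m (m x y) z + m y (m x z))"

definition endo_on :: "('k::field \<Rightarrow> 'v::ab_group_add \<Rightarrow> 'v) \<Rightarrow> 'v set \<Rightarrow> ('v \<Rightarrow> 'v) \<Rightarrow> bool" where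
  "endo_on s V f \<longleftrightarrow>
     f ` V \<subseteq> V \<and> (\<forall>u\<in>V. \<forall>v\<in>V. f (u + v) = f u + f v) \<and> (\<forall>c. \<forall>v\<in>V. f (s c v) = s c (f v))"

definition linear_to_endo ::
  "('k::field \<Rightarrow> 'a::ab_group_add \<Rightarrow> 'a) \<Rightarrow> ('k \<Rightarrow> 'v::ab_group_add \<Rightarrow> 'v) \<Rightarrow> 'v set \<Rightarrow>
    ('a \<Rightarrow> 'v \<Rightarrow> 'v) \<Rightarrow> bool" where
  "linear_to_endo s sV V \<rho> \<longleftrightarrow>
     (\<forall>x. endo_on sV V (\<rho> x)) \<and>
     (\<forall>x y. \<forall>v\<in>V. \<rho> (x + y) v = \<rho> x v + \<rho> y v) \<and>
     (\<forall>c x. \<forall>v\<in>V. \<rho> (s c x) v = sV c (\<rho> x v))"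

definition leibniz_representation ::
  "('k::field \<Rightarrow> 'a::ab_group_add \<Rightarrow> 'a) \<Rightarrow> ('a \<Rightarrow> 'a \<Rightarrow> 'a) \<Rightarrow>
   ('k \<Rightarrow> 'v::ab_group_add \<Rightarrow> 'v) \<Rightarrow> ('a \<Rightarrow> 'v \<Rightarrow> 'v) \<Rightarrow> ('a \<Rightarrow> 'v \<Rightarrow> 'v) \<Rightarrow> 'v set \<Rightarrow> bool" where
  "leibniz_representation s m sV l r V \<longleftrightarrow>
     leibniz_algebra s m \<and> findim_space_on sV V \<and>
     linear_to_endo s sV V l \<and> linear_to_endo s sV V r \<and>
     (\<forall>x y. \<forall>v\<in>V.
        l (m x y) v = l x (l y v) - l y (l x v) \<and>
        r (m x y) v = l x (r y v) - r y (l x v) \<and>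
        r y (l x v) = - r y (r x v))"

definition left_mult :: "('a \<Rightarrow> 'a \<Rightarrow> 'a) \<Rightarrow> 'a \<Rightarrow> 'a \<Rightarrow> 'a" where
  "left_mult m x y = m x y"

definition right_mult :: "('a \<Rightarrow> 'a \<Rightarrow> 'a) \<Rightarrow> 'a \<Rightarrow> 'a \<Rightarrow> 'a" where
  "right_mult m x y = m y x"

definition dual_space :: "('k::field \<Rightarrow> 'v::ab_group_add \<Rightarrow> 'v) \<Rightarrow> ('v \<Rightarrow> 'k) set" where
  "dual_space s = {u. Vector_Spaces.linear s (*) u}"

definition dual_scale :: "'k::field \<Rightarrow> ('v \<Rightarrow> 'k) \<Rightarrow> 'v \<Rightarrow> 'k" where
  "dual_scale c u = (\<lambda>v. c * u v)"

definition dual_op :: "('a \<Rightarrow> 'v \<Rightarrow> 'v) \<Rightarrow> 'a \<Rightarrow> ('v \<Rightarrow> 'k::field) \<Rightarrow> 'v \<Rightarrow> 'k" where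
  "dual_op \<rho> x u = (\<lambda>v. - u (\<rho> x v))"

definition lin_comb ::
  "('k \<Rightarrow> 'v::ab_group_add \<Rightarrow> 'v) \<Rightarrow> 'k \<Rightarrow> ('a \<Rightarrow> 'v \<Rightarrow> 'v) \<Rightarrow> 'k \<Rightarrow> ('a \<Rightarrow> 'v \<Rightarrow> 'v) \<Rightarrow> 'a \<Rightarrow> 'v \<Rightarrow> 'v" where
  "lin_comb sV c \<rho> d \<sigma> = (\<lambda>x v. sV c (\<rho> x v) + sV d (\<sigma> x v))"

text \<open>
  In both definitions below, \<open>M $ i $ j\<close> is the entry in row \<open>i\<close> and column \<open>j\<close>: the first column
  gives the coefficients of \<open>l\<close>, the second column those of \<open>r\<close>.
\<close>

definition pre_leibniz ::
  "'k::field ^ 2 ^ 2 \<Rightarrow> ('k \<Rightarrow> 'a::ab_group_add \<Rightarrow> 'a) \<Rightarrow> ('a \<Rightarrow> 'a \<Rightarrow> 'a) \<Rightarrow> ('a \<Rightarrow> 'a \<Rightarrow> 'a) \<Rightarrow> bool" where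
  "pre_leibniz M s sc pr \<longleftrightarrow>
     leibniz_algebra s (\<lambda>x y. sc x y + pr x y) \<and>
     leibniz_representation s (\<lambda>x y. sc x y + pr x y) s
       (lin_comb s (M $ 1 $ 1) (left_mult sc) (M $ 2 $ 1) (right_mult pr))
       (lin_comb s (M $ 1 $ 2) (left_mult sc) (M $ 2 $ 2) (right_mult pr))
       UNIV"

definition dual_pre_leibniz ::
  "'k::field ^ 2 ^ 2 \<Rightarrow> ('k \<Rightarrow> 'a::ab_group_add \<Rightarrow> 'a) \<Rightarrow> ('a \<Rightarrow> 'a \<Rightarrow> 'a) \<Rightarrow> ('a \<Rightarrow> 'a \<Rightarrow> 'a) \<Rightarrow> bool" where
  "dual_pre_leibniz M s sc pr \<longleftrightarrow>
     leibniz_algebra s (\<lambda>x y. sc x y + pr x y) \<and>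
     leibniz_representation s (\<lambda>x y. sc x y + pr x y) dual_scale
       (lin_comb dual_scale (M $ 1 $ 1) (dual_op (left_mult sc)) (M $ 2 $ 1) (dual_op (right_mult pr)))
       (lin_comb dual_scale (M $ 1 $ 2) (dual_op (left_mult sc)) (M $ 2 $ 2) (dual_op (right_mult pr)))
       (dual_space s)"

end

(* On the regular module, the type-a data are the operators l = L_bul and r = -L_succ, and the
   dual type-b data are the duals of l = L_bul and R_prec = L_succ - L_bul.  Dualizing a
   representation condition reverses the order of composition, and functionals separate points, so
   the dual conditions are identities between operators on A.  Modulo the first of them, the second
   condition for R_prec differs from the second one for L_succ by that first identity, and both
   third conditions say that x succ (z prec y) = 0. *)
theory Submission
  imports Defs
begin

section \<open>Bilinear multiplications and their multiplication operators\<close>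

lemma bilinear_mult_iff:
  "bilinear_mult s m \<longleftrightarrow> vector_space s \<and>
     (\<forall>x y z. m x (y + z) = m x y + m x z \<and> m (x + y) z = m x z + m y z) \<and>
     (\<forall>c x y. m x (s c y) = s c (m x y) \<and> m (s c x) y = s c (m x y))"
  unfolding bilinear_mult_def Vector_Spaces.linear_iff by auto

lemma bilinear_mult_minus:
  assumes "bilinear_mult s m"
  shows "m x (- y) = - m x y" and "m (- x) y = - m x y"
proof -
  interpret l: Vector_Spaces.linear s s "m x" using assms by (simp add: bilinear_mult_def)
  interpret r: Vector_Spaces.linear s s "\<lambda>x. m x y" using assms by (simp add: bilinear_mult_def)
  show "m x (- y) = - m x y" by (rule l.neg)
  show "m (- x) y = - m x y" by (rule r.neg)
qed

lemma linear_to_endo_left_mult: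
  "bilinear_mult s m \<Longrightarrow> linear_to_endo s s UNIV (left_mult m)"
  by (auto simp: bilinear_mult_iff linear_to_endo_def endo_on_def left_mult_def)

lemma linear_to_endo_right_mult:
  "bilinear_mult s m \<Longrightarrow> linear_to_endo s s UNIV (right_mult m)"
  by (auto simp: bilinear_mult_iff linear_to_endo_def endo_on_def right_mult_def)

text \<open>Additivity and homogeneity evaluate the operators at \<open>u + v\<close> and
  \<open>sV c v\<close> as well. These vectors stay in the subspace \<open>V\<close>, so agreement
  on \<open>V\<close> is enough.\<close>

lemma linear_to_endo_cong:
  fixes sV :: "'k::field \<Rightarrow> 'v::ab_group_add \<Rightarrow> 'v"
  assumes "\<And>x v. v \<in> V \<Longrightarrow> \<rho> x v = \<rho>' x v"
    and "module.subspace sV V"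
    and "vector_space sV"
  shows "linear_to_endo s sV V \<rho> \<longleftrightarrow> linear_to_endo s sV V \<rho>'"
proof -
  interpret vector_space sV by fact
  show ?thesis
    using assms(1) subspace_add[OF assms(2)] subspace_scale[OF assms(2)]
    by (simp add: linear_to_endo_def endo_on_def image_subset_iff cong: ball_cong)
qed

text \<open>Operators are functions on a whole ambient type, but only their restrictions to
  \<open>V\<close> matter. This is needed for the dual space: identities between dual operators may
  hold only at linear functionals and fail at arbitrary functions.\<close>

lemma leibniz_representation_cong:
  fixes sV :: "'k::field \<Rightarrow> 'v::ab_group_add \<Rightarrow> 'v"
  assumes l: "\<And>x v. v \<in> V \<Longrightarrow> l x v = l' x v"
    and r: "\<And>x v. v \<in> V \<Longrightarrow> r x v = r' x v"
  shows "leibniz_representation s m sV l r V \<longleftrightarrow> leibniz_representation s m sV l' r' V"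
proof (cases "findim_space_on sV V")
  case True
  then obtain B where vs: "vector_space sV" and B: "module.span sV B = V"
    by (auto simp: findim_space_on_def)
  interpret vector_space sV by (rule vs)
  have V: "subspace V"
    using B subspace_span by blast
  have endo_iff: "linear_to_endo s sV V l \<longleftrightarrow> linear_to_endo s sV V l'"
    "linear_to_endo s sV V r \<longleftrightarrow> linear_to_endo s sV V r'"
    by (rule linear_to_endo_cong[OF _ V vs]; simp add: l r)+
  \<comment> \<open>In a composite such as \<open>l x (l y v)\<close> the outer operator can be
    replaced only once the inner value is known to lie in \<open>V\<close>.\<close>
  have stable: "l' x v \<in> V" "r' x v \<in> V"
    if "linear_to_endo s sV V l'" "linear_to_endo s sV V r'" "v \<in> V" for x v
    using that by (simp_all add: linear_to_endo_def endo_on_def image_subset_iff)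
  show ?thesis
    unfolding leibniz_representation_def endo_iff
    using stable by (auto simp: l r)
qed (simp add: leibniz_representation_def)

section \<open>Linear functionals and the dual space\<close>

lemma vector_space_times: "vector_space ((*) :: 'k::field \<Rightarrow> 'k \<Rightarrow> 'k)"
  by unfold_locales (auto simp: algebra_simps)

lemma vector_space_dual_scale:
  "vector_space (dual_scale :: 'k::field \<Rightarrow> ('v \<Rightarrow> 'k) \<Rightarrow> 'v \<Rightarrow> 'k)"
  by unfold_locales (auto simp: dual_scale_def fun_eq_iff algebra_simps)

lemma mem_dual_space_iff:
  assumes "vector_space s"
  shows "u \<in> dual_space s \<longleftrightarrow> (\<forall>x y. u (x + y) = u x + u y) \<and> (\<forall>c x. u (s c x) = c * u x)"
  using assms vector_space_times by (auto simp: dual_space_def Vector_Spaces.linear_iff)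

lemma dual_space_diff:
  assumes "u \<in> dual_space s"
  shows "u (x - y) = u x - u y"
proof -
  interpret Vector_Spaces.linear s "(*)" u using assms by (simp add: dual_space_def)
  show ?thesis by (rule diff)
qed

lemma dual_space_minus:
  assumes "u \<in> dual_space s"
  shows "u (- x) = - u x"
proof -
  interpret Vector_Spaces.linear s "(*)" u using assms by (simp add: dual_space_def)
  show ?thesis by (rule neg)
qed

lemma dual_space_extends:
  fixes s :: "'k::field \<Rightarrow> 'v::ab_group_add \<Rightarrow> 'v"
  assumes "vector_space s" and "\<not> module.dependent s B"
  obtains u where "u \<in> dual_space s" "\<forall>b\<in>B. u b = f b"
proof -
  interpret vector_space_pair s "(*) :: 'k \<Rightarrow> 'k \<Rightarrow> 'k"
    using assms(1) vector_space_times by (simp add: vector_space_pair_def)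
  show thesis
    using linear_independent_extend[OF assms(2), of f] that by (auto simp: dual_space_def)
qed

text \<open>A nonzero difference forms an independent singleton, so some functional takes the value
  1 on it.\<close>

lemma dual_space_separates:
  assumes "vector_space s" and "\<And>u. u \<in> dual_space s \<Longrightarrow> u x = u y"
  shows "x = y"
proof (rule ccontr)
  assume "x \<noteq> y"
  interpret vector_space s by fact
  have "independent {x - y}"
    using \<open>x \<noteq> y\<close> by simp
  then obtain u where "u \<in> dual_space s" "u (x - y) = 1"
    using dual_space_extends[OF assms(1), of "{x - y}" "\<lambda>_. 1"] by auto
  then show False
    using assms(2)[of u] by (simp add: dual_space_diff)
qed

text \<open>The functionals dual to a finite basis span the dual space, the coefficients of
  \<open>u\<close> being its values on the basis.\<close>

lemma findim_space_on_dual_space: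
  assumes "findim_space_on s UNIV"
  shows "findim_space_on dual_scale (dual_space s)"
proof -
  from assms obtain C where vs: "vector_space s" and C: "finite C" "module.span s C = UNIV"
    by (auto simp: findim_space_on_def)
  interpret vector_space s by (rule vs)
  interpret D: vector_space dual_scale by (rule vector_space_dual_scale)
  \<comment> \<open>Choosing the basis inside the finite spanning set \<open>C\<close> makes it
    finite.\<close>
  obtain B where B: "B \<subseteq> C" "independent B" "span B = UNIV"
    using maximal_independent_subset[of C] C
    by (metis span_mono span_span top.extremum_unique)
  have "finite B" using B(1) C(1) by (rule finite_subset)
  have "\<exists>u. u \<in> dual_space s \<and> (\<forall>b\<in>B. u b = (if b = c then 1 else 0))" for c
    using dual_space_extends[OF vs B(2), of "\<lambda>b. if b = c then 1 else 0"] by metis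
  then obtain e where e: "\<And>c. e c \<in> dual_space s"
      "\<And>c b. b \<in> B \<Longrightarrow> e c b = (if b = c then 1 else 0)"
    by metis
  have sub: "D.subspace (dual_space s)"
    by (rule D.subspaceI)
       (auto simp: mem_dual_space_iff[OF vs] dual_scale_def algebra_simps)
  have expand: "u = (\<Sum>b\<in>B. dual_scale (u b) (e b))" if u: "u \<in> dual_space s" for u
  proof -
    interpret vector_space_pair s "(*)"
      using vs vector_space_times by (simp add: vector_space_pair_def)
    have "(\<Sum>b\<in>B. dual_scale (u b) (e b)) \<in> dual_space s"
      by (intro D.subspace_sum[OF sub] D.subspace_scale[OF sub] e(1))
    then have lin: "Vector_Spaces.linear s (*) (\<Sum>b\<in>B. dual_scale (u b) (e b))"
      by (simp add: dual_space_def)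
    have eval: "(\<Sum>b\<in>B. dual_scale (u b) (e b)) x = (\<Sum>b\<in>B. u b * e b x)" for x
      using \<open>finite B\<close> by (induction B rule: finite_induct) (auto simp: dual_scale_def)
    have "u x = (\<Sum>b\<in>B. dual_scale (u b) (e b)) x" for x
    \<comment> \<open>Both sides are linear, so comparing them on the basis suffices; there only the
      summand with index \<open>b\<close> survives.\<close>
    proof (rule linear_eq_on[OF _ lin, of u x B])
      show "Vector_Spaces.linear s (*) u" using u by (simp add: dual_space_def)
      show "x \<in> span B" by (simp add: B(3))
      show "u b = (\<Sum>b\<in>B. dual_scale (u b) (e b)) b" if "b \<in> B" for b
        unfolding eval using that \<open>finite B\<close> by (simp add: e(2) if_distrib cong: if_cong)
    qed
    then show ?thesis by (rule ext)
  qed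
  have "D.span (e ` B) = dual_space s"
  proof
    show "D.span (e ` B) \<subseteq> dual_space s"
      using e(1) by (intro D.span_minimal[OF _ sub]) auto
    show "dual_space s \<subseteq> D.span (e ` B)"
    proof
      fix u assume "u \<in> dual_space s"
      then have "u = (\<Sum>b\<in>B. dual_scale (u b) (e b))" by (rule expand)
      also have "\<dots> \<in> D.span (e ` B)"
        by (intro D.span_sum D.span_scale D.span_base imageI)
      finally show "u \<in> D.span (e ` B)" .
    qed
  qed
  then show ?thesis
    using \<open>finite B\<close> D.vector_space_axioms by (auto simp: findim_space_on_def)
qed

section \<open>Dual operators and dual representations\<close>

lemma linear_to_endo_dual_op:
  assumes vs: "vector_space sV" and \<rho>: "linear_to_endo s sV UNIV \<rho>"
  shows "linear_to_endo s dual_scale (dual_space sV) (dual_op \<rho>)"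
  using \<rho>
  by (auto simp: linear_to_endo_def endo_on_def mem_dual_space_iff[OF vs] dual_op_def
      dual_scale_def fun_eq_iff)

text \<open>Transposition reverses products, and the sign in \<open>dual_op\<close> undoes the
  resulting change of sign of a commutator. So the two commutator conditions keep their form, while
  in the third condition \<open>r y\<close> moves to the inner position.\<close>

lemma leibniz_representation_dual_op_iff:
  fixes s :: "'k::field \<Rightarrow> 'a::ab_group_add \<Rightarrow> 'a"
    and sV :: "'k \<Rightarrow> 'v::ab_group_add \<Rightarrow> 'v"
  assumes m: "leibniz_algebra s m" and V: "findim_space_on sV UNIV"
    and l: "linear_to_endo s sV UNIV l" and r: "linear_to_endo s sV UNIV r"
  shows "leibniz_representation s m dual_scale (dual_op l) (dual_op r) (dual_space sV) \<longleftrightarrow>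
    (\<forall>x y v. l (m x y) v = l x (l y v) - l y (l x v) \<and>
             r (m x y) v = l x (r y v) - r y (l x v) \<and>
             l x (r y v) = - r x (r y v))"
    (is "_ \<longleftrightarrow> ?R")
proof -
  have vs: "vector_space sV" using V by (simp add: findim_space_on_def)
  have eq_iff: "(\<forall>u\<in>dual_space sV. u v = u w) \<longleftrightarrow> v = w" for v w
    using dual_space_separates[OF vs] by blast
  have neg_iff: "- a = b - c \<longleftrightarrow> a = c - b" for a b c :: 'k
    by (metis minus_diff_eq minus_minus)
  \<comment> \<open>With three independent families this covers both commutator conditions:
    \<open>f\<close>, \<open>g\<close>, \<open>h\<close> are \<open>l\<close>, \<open>l\<close>,
    \<open>l\<close> in the first and \<open>r\<close>, \<open>l\<close>, \<open>r\<close> in the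
    second.\<close>
  have eq1: "dual_op f z u = dual_op g x (dual_op h y u) - dual_op h y (dual_op g x u) \<longleftrightarrow>
      (\<forall>v. u (f z v) = u (g x (h y v) - h y (g x v)))"
    if "u \<in> dual_space sV" for f g h :: "'a \<Rightarrow> 'v \<Rightarrow> 'v" and x y z u
    by (simp add: dual_op_def fun_eq_iff dual_space_diff[OF that] neg_iff)
  have eq2: "dual_op r y (dual_op l x u) = - dual_op r y (dual_op r x u) \<longleftrightarrow>
      (\<forall>v. u (l x (r y v)) = u (- r x (r y v)))"
    if "u \<in> dual_space sV" for x y u
    using dual_space_minus[OF that] by (auto simp: dual_op_def fun_eq_iff)
  \<comment> \<open>Moving the quantifier over \<open>u\<close> innermost puts each equation in the
    form to which separation by functionals applies.\<close>
  have "leibniz_representation s m dual_scale (dual_op l) (dual_op r) (dual_space sV) \<longleftrightarrow>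
    (\<forall>x y v. (\<forall>u\<in>dual_space sV. u (l (m x y) v) = u (l x (l y v) - l y (l x v))) \<and>
       (\<forall>u\<in>dual_space sV. u (r (m x y) v) = u (l x (r y v) - r y (l x v))) \<and>
       (\<forall>u\<in>dual_space sV. u (l x (r y v)) = u (- r x (r y v))))"
    using m findim_space_on_dual_space[OF V] linear_to_endo_dual_op[OF vs l]
      linear_to_endo_dual_op[OF vs r]
    by (auto simp: leibniz_representation_def eq1 eq2)
  also have "\<dots> \<longleftrightarrow> ?R" by (simp only: eq_iff)
  finally show ?thesis .
qed

theorem proposition3p6:
  fixes scale :: "'k::{alg_closed_field, field_char_0} \<Rightarrow> 'a::ab_group_add \<Rightarrow> 'a"
    and sc :: "'a \<Rightarrow> 'a \<Rightarrow> 'a" (infixl "\<succ>\<^sub>A" 70)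
    and pr :: "'a \<Rightarrow> 'a \<Rightarrow> 'a" (infixl "\<prec>\<^sub>A" 70)
    and circ :: "'a \<Rightarrow> 'a \<Rightarrow> 'a" (infixl "\<circ>\<^sub>A" 70)
    and bul :: "'a \<Rightarrow> 'a \<Rightarrow> 'a" (infixl "\<bullet>\<^sub>A" 70)
  assumes A: "findim_space_on scale (UNIV :: 'a set)"
    and bilin_succ: "bilinear_mult scale sc"
    and bilin_prec: "bilinear_mult scale pr"
    and circ: "\<And>x y. x \<circ>\<^sub>A y = x \<succ>\<^sub>A y + x \<prec>\<^sub>A y"
    and bul: "\<And>x y. x \<bullet>\<^sub>A y = x \<succ>\<^sub>A y - y \<prec>\<^sub>A x"
  shows
    "(pre_leibniz (vector [vector [1, -1], vector [-1, 0]]) scale sc pr \<longleftrightarrow>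
      dual_pre_leibniz (vector [vector [1, 0], vector [-1, 1]]) scale sc pr)
   \<and> (dual_pre_leibniz (vector [vector [1, 0], vector [-1, 1]]) scale sc pr \<longleftrightarrow>
      (leibniz_algebra scale circ \<and>
       (\<forall>x y z.
          (x \<circ>\<^sub>A y) \<bullet>\<^sub>A z = x \<bullet>\<^sub>A (y \<bullet>\<^sub>A z) - y \<bullet>\<^sub>A (x \<bullet>\<^sub>A z) \<and>
          z \<prec>\<^sub>A (x \<circ>\<^sub>A y) = x \<bullet>\<^sub>A (z \<prec>\<^sub>A y) - (x \<bullet>\<^sub>A z) \<prec>\<^sub>A y \<and>
          x \<bullet>\<^sub>A (z \<prec>\<^sub>A y) = - ((z \<prec>\<^sub>A y) \<prec>\<^sub>A x))))
   \<and> (pre_leibniz (vector [vector [1, -1], vector [-1, 0]]) scale sc pr \<longrightarrow>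
      leibniz_representation scale circ dual_scale
        (dual_op (left_mult bul)) (dual_op (right_mult pr)) (dual_space scale) \<and>
      leibniz_representation scale circ scale
        (left_mult bul) (\<lambda>x v. - left_mult sc x v) UNIV)"
proof -
  have vs: "vector_space scale" using A by (simp add: findim_space_on_def)
  interpret vector_space scale by (rule vs)
  note succ_linear = bilin_succ[unfolded bilinear_mult_iff]
  note prec_linear = bilin_prec[unfolded bilinear_mult_iff]
  have circ_eq: "(\<lambda>x y. x \<succ>\<^sub>A y + x \<prec>\<^sub>A y) = circ"
    by (simp add: circ fun_eq_iff)
  \<comment> \<open>This eliminates \<open>sc\<close>, leaving \<open>bul\<close> and
    \<open>pr\<close> as the basic operations.\<close>
  have sc_eq: "x \<succ>\<^sub>A y = x \<bullet>\<^sub>A y + y \<prec>\<^sub>A x" for x y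
    by (simp add: bul)
  have bilin_bul: "bilinear_mult scale bul"
    using succ_linear prec_linear vs
    by (simp add: bilinear_mult_iff bul algebra_simps)
  have endo_bul: "linear_to_endo scale scale UNIV (left_mult bul)"
    and endo_prec: "linear_to_endo scale scale UNIV (right_mult pr)"
    using bilin_bul bilin_prec by (auto intro: linear_to_endo_left_mult linear_to_endo_right_mult)
  have endo_succ: "linear_to_endo scale scale UNIV (\<lambda>x v. - left_mult sc x v)"
    using succ_linear by (simp add: linear_to_endo_def endo_on_def left_mult_def)
  define identities where "identities \<longleftrightarrow> (\<forall>x y z.
          (x \<circ>\<^sub>A y) \<bullet>\<^sub>A z = x \<bullet>\<^sub>A (y \<bullet>\<^sub>A z) - y \<bullet>\<^sub>A (x \<bullet>\<^sub>A z) \<and>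
          z \<prec>\<^sub>A (x \<circ>\<^sub>A y) = x \<bullet>\<^sub>A (z \<prec>\<^sub>A y) - (x \<bullet>\<^sub>A z) \<prec>\<^sub>A y \<and>
          x \<bullet>\<^sub>A (z \<prec>\<^sub>A y) = - ((z \<prec>\<^sub>A y) \<prec>\<^sub>A x))"
  let ?ra = "leibniz_representation scale circ scale
        (left_mult bul) (\<lambda>x v. - left_mult sc x v) UNIV"
  let ?rb = "leibniz_representation scale circ dual_scale
        (dual_op (left_mult bul)) (dual_op (right_mult pr)) (dual_space scale)"
  have a: "pre_leibniz (vector [vector [1, -1], vector [-1, 0]]) scale sc pr \<longleftrightarrow>
      leibniz_algebra scale circ \<and> ?ra"
  proof -
    have "lin_comb scale 1 (left_mult sc) (-1) (right_mult pr) = left_mult bul"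
      "lin_comb scale (-1) (left_mult sc) 0 (right_mult pr) = (\<lambda>x v. - left_mult sc x v)"
      by (simp_all add: lin_comb_def left_mult_def right_mult_def bul fun_eq_iff)
    then show ?thesis by (simp add: pre_leibniz_def circ_eq)
  qed
  have b: "dual_pre_leibniz (vector [vector [1, 0], vector [-1, 1]]) scale sc pr \<longleftrightarrow>
      leibniz_algebra scale circ \<and> ?rb"
  proof -
    \<comment> \<open>The first equality uses \<open>u (v - w) = u v - u w\<close>, hence the
      restriction to linear functionals and the passage through the congruence lemma.\<close>
    have "lin_comb dual_scale 1 (dual_op (left_mult sc)) (-1) (dual_op (right_mult pr)) x u =
        dual_op (left_mult bul) x u"
      "lin_comb dual_scale 0 (dual_op (left_mult sc)) 1 (dual_op (right_mult pr)) x u =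
        dual_op (right_mult pr) x u"
      if "u \<in> dual_space scale" for x u
      using dual_space_diff[OF that]
      by (simp_all add: lin_comb_def dual_op_def dual_scale_def left_mult_def right_mult_def bul
          fun_eq_iff)
    note cong = leibniz_representation_cong[OF this]
    show ?thesis by (simp add: dual_pre_leibniz_def circ_eq cong)
  qed
  have dual: "?rb \<longleftrightarrow> identities" if "leibniz_algebra scale circ"
    unfolding leibniz_representation_dual_op_iff[OF that A endo_bul endo_prec] identities_def
    by (simp add: left_mult_def right_mult_def)
  have regular: "?ra \<longleftrightarrow> identities" if "leibniz_algebra scale circ"
  proof -
    \<comment> \<open>In the third condition the two signs of \<open>r y (r x z)\<close> cancel, so
      both sides carry one overall minus sign, which is dropped.\<close>
    have "?ra \<longleftrightarrow> (\<forall>x y z.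
          (x \<circ>\<^sub>A y) \<bullet>\<^sub>A z = x \<bullet>\<^sub>A (y \<bullet>\<^sub>A z) - y \<bullet>\<^sub>A (x \<bullet>\<^sub>A z) \<and>
          - ((x \<circ>\<^sub>A y) \<succ>\<^sub>A z) = x \<bullet>\<^sub>A (- (y \<succ>\<^sub>A z)) + y \<succ>\<^sub>A (x \<bullet>\<^sub>A z) \<and>
          y \<succ>\<^sub>A (x \<bullet>\<^sub>A z) = y \<succ>\<^sub>A (x \<succ>\<^sub>A z))"
      using that A endo_bul endo_succ
      by (simp add: leibniz_representation_def left_mult_def bilinear_mult_minus[OF bilin_succ])
    also have "\<dots> \<longleftrightarrow> identities"
    proof -
      have neg_bul: "x \<bullet>\<^sub>A (- y) = - (x \<bullet>\<^sub>A y)" for x y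
        by (rule bilinear_mult_minus[OF bilin_bul])
      have add_bul: "x \<bullet>\<^sub>A (y + z) = x \<bullet>\<^sub>A y + x \<bullet>\<^sub>A z" for x y z
        using bilin_bul by (simp add: bilinear_mult_iff)
      \<comment> \<open>Expanding \<open>sc\<close> on both sides by \<open>sc_eq\<close> produces
        exactly the terms of the first identity, which cancel; what remains is the identity for
        \<open>pr\<close>.\<close>
      have second: "- ((x \<circ>\<^sub>A y) \<succ>\<^sub>A z) = x \<bullet>\<^sub>A (- (y \<succ>\<^sub>A z)) + y \<succ>\<^sub>A (x \<bullet>\<^sub>A z) \<longleftrightarrow>
          z \<prec>\<^sub>A (x \<circ>\<^sub>A y) = x \<bullet>\<^sub>A (z \<prec>\<^sub>A y) - (x \<bullet>\<^sub>A z) \<prec>\<^sub>A y"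
        if "(x \<circ>\<^sub>A y) \<bullet>\<^sub>A z = x \<bullet>\<^sub>A (y \<bullet>\<^sub>A z) - y \<bullet>\<^sub>A (x \<bullet>\<^sub>A z)" for x y z
      proof -
        have "- ((x \<circ>\<^sub>A y) \<succ>\<^sub>A z) = x \<bullet>\<^sub>A (- (y \<succ>\<^sub>A z)) + y \<succ>\<^sub>A (x \<bullet>\<^sub>A z) \<longleftrightarrow>
          (x \<circ>\<^sub>A y) \<succ>\<^sub>A z = x \<bullet>\<^sub>A (y \<succ>\<^sub>A z) - y \<succ>\<^sub>A (x \<bullet>\<^sub>A z)"
          unfolding neg_bul by (auto simp: algebra_simps)
        also have "\<dots> \<longleftrightarrow> z \<prec>\<^sub>A (x \<circ>\<^sub>A y) = x \<bullet>\<^sub>A (z \<prec>\<^sub>A y) - (x \<bullet>\<^sub>A z) \<prec>\<^sub>A y"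
          unfolding sc_eq that add_bul by (auto simp: algebra_simps)
        finally show ?thesis .
      qed
      \<comment> \<open>The left equation says that \<open>y\<close> times \<open>z\<close>
        \<open>pr\<close> \<open>x\<close> under \<open>sc\<close> vanishes, since \<open>sc\<close>
        and \<open>bul\<close> differ by that inner product. Expanding \<open>bul\<close> on the
        right gives the same condition.\<close>
      have third: "y \<succ>\<^sub>A (x \<bullet>\<^sub>A z) = y \<succ>\<^sub>A (x \<succ>\<^sub>A z) \<longleftrightarrow>
          y \<bullet>\<^sub>A (z \<prec>\<^sub>A x) = - ((z \<prec>\<^sub>A x) \<prec>\<^sub>A y)" for x y z
      proof -
        have "y \<succ>\<^sub>A (x \<succ>\<^sub>A z) = y \<succ>\<^sub>A (x \<bullet>\<^sub>A z) + y \<succ>\<^sub>A (z \<prec>\<^sub>A x)"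
          unfolding sc_eq[of x z] using succ_linear by blast
        then show ?thesis by (simp add: bul)
      qed
      \<comment> \<open>The third equations match after exchanging the bound variables
        \<open>x\<close> and \<open>y\<close>.\<close>
      show ?thesis unfolding identities_def third using second by blast
    qed
    finally show ?thesis .
  qed
  \<comment> \<open>Once \<open>circ\<close> is Leibniz, \<open>?ra\<close> and \<open>?rb\<close>
    are both equivalent to \<open>identities\<close>; so (a) yields both representations of the
    final claim.\<close>
  show ?thesis
    unfolding a b identities_def[symmetric] using dual regular by blast
qed

end
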